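(* Let $d,k,l,m,n$ be positive integers satisfying $l<kd<md$ and $kn-1\le m(n-1)$, and let $g=\gcd(kd,kd-l)$. Then $$\frac{\{(dm-l)n-(m-1)d\}}{\{gn\}}\left\{{m(n-1):d\atop kn-1:d}\right\}$$ is in $\mathbb{N}[s,t]$.
   Context: Let $s,t$ be indeterminates and $\mathbb{N}=\{0,1,2,\dots\}$. The Lucas sequence is $\{0\}=0$, $\{1\}=1$, $\{n\}=s\{n-1\}+t\{n-2\}$ for $n\ge 2$. The $d$-divisible Lucastorial is $\{n:d\}!=\{d\}\{2d\}\cdots\{nd\}$, with $\{0:d\}!=1$, and for $0\le k\le n$ the $d$-divisible Lucasnomial is $\left\{{n:d\atop k:d}\right\}=\frac{\{n:d\}!}{\{k:d\}!\,\{n-k:d\}!}$. *)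

theory Defs
  imports "HOL-Computational_Algebra.Computational_Algebra"
begin

text \<open>
  The bivariate ring \<open>\<int>[s,t]\<close> is represented as \<open>\<int>[s][t]\<close>, i.e. as \<open>int poly poly\<close>:
  the outer variable is \<open>t\<close>, and its coefficients are polynomials in \<open>s\<close>. So the
  coefficient of \<open>s^i t^j\<close> in \<open>p\<close> is \<open>coeff (coeff p j) i\<close>. Quotients are formed in
  the field of fractions \<open>int poly poly fract\<close>.
\<close>

definition var_s :: "int poly poly" where
  "var_s = [:[:0, 1:]:]"

definition var_t :: "int poly poly" where
  "var_t = [:0, 1:]"

fun lucas :: "nat \<Rightarrow> int poly poly" where
  "lucas 0 = 0"
| "lucas (Suc 0) = 1"
| "lucas (Suc (Suc n)) = var_s * lucas (Suc n) + var_t * lucas n"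

definition lucastorial :: "nat \<Rightarrow> nat \<Rightarrow> int poly poly" where
  "lucastorial n d = (\<Prod>i = 1..n. lucas (i * d))"

text \<open>
  The notion is only intended for \<open>k \<le> n\<close> (otherwise \<open>n - k\<close> is truncated) and
  \<open>d > 0\<close> (otherwise the denominator may vanish).
\<close>
definition lucasnomial :: "nat \<Rightarrow> nat \<Rightarrow> nat \<Rightarrow> int poly poly fract" where
  "lucasnomial n k d = Fract (lucastorial n d) (lucastorial k d * lucastorial (n - k) d)"

text \<open>\<open>\<nat>[s,t]\<close> as a subset of the field of fractions of \<open>\<int>[s,t]\<close>.\<close>
definition nat_polys :: "int poly poly fract set" where
  "nat_polys = {Fract p 1 | p. \<forall>i j. coeff (coeff p j) i \<ge> 0}"

lemma lucas_nonzero: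
  assumes "n > 0"
  shows "lucas n \<noteq> 0"
proof -
  define e where "e p = poly (poly p 1) (1::int)" for p
  have e: "e (p + q) = e p + e q" "e (p * q) = e p * e q" "e var_s = 1" "e var_t = 1"
    "e 0 = 0" "e 1 = 1" for p q
    by (simp_all add: e_def var_s_def var_t_def)
  have "e (lucas n) \<ge> 0 \<and> (n > 0 \<longrightarrow> e (lucas n) > 0)"
    by (induction n rule: lucas.induct) (simp_all add: e)
  with assms e(5) show ?thesis by auto
qed

lemma lucastorial_nonzero:
  assumes "d > 0"
  shows "lucastorial n d \<noteq> 0"
  using assms by (auto simp: lucastorial_def lucas_nonzero)

text \<open>
  Under the hypotheses of the theorem the index \<open>(dm - l)n - (m - 1)d\<close> is positive, so
  the subtractions on natural numbers in it agree with those on integers.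
\<close>
lemma index_no_truncation:
  fixes d k l m n :: nat
  assumes "d > 0" "k > 0" "l > 0" "m > 0" "n > 0"
    and "l < k * d" "k * d < m * d" "k * n - 1 \<le> m * (n - 1)"
  shows "int ((d * m - l) * n - (m - 1) * d)
           = (int d * int m - int l) * int n - (int m - 1) * int d"
    and "(d * m - l) * n - (m - 1) * d > 0"
proof -
  obtain m' n' where mn: "m = Suc m'" "n = Suc n'"
    using assms(4,5) by (metis gr0_implies_Suc)
  have le: "k * n \<le> m * n' + 1"
    using assms(8) by (simp add: mn)
  have "d * (k * n) \<le> d * (m * n' + 1)"
    using le by (rule mult_le_mono2)
  then have 1: "int d * int k * int n \<le> int d * int m * int n' + int d"
    by (simp add: algebra_simps flip: of_nat_mult of_nat_add)
  have "l * n < k * d * n"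
    using assms(5,6) by simp
  then have 2: "int l * int n < int d * int k * int n"
    by (metis of_nat_less_iff of_nat_mult mult.commute)
  have "l \<le> d * m"
    using less_trans[OF assms(6,7)] by (simp add: mult.commute)
  then have 3: "int ((d * m - l) * n) = (int d * int m - int l) * int n"
    by (simp add: of_nat_diff)
  have 4: "int ((m - 1) * d) = (int m - 1) * int d"
    by (simp add: mn)
  have 5: "(int d * int m - int l) * int n - (int m - 1) * int d > 0"
    using 1 2 by (simp add: mn algebra_simps)
  have "(m - 1) * d < (d * m - l) * n"
    using 3 4 5 by linarith
  then show "(d * m - l) * n - (m - 1) * d > 0"
    and "int ((d * m - l) * n - (m - 1) * d)
           = (int d * int m - int l) * int n - (int m - 1) * int d"
    using 3 4 by (simp_all add: of_nat_diff)
qed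

end

theory Submission
  imports Defs
begin

text \<open>
  Write \<open>{x}\<close> for \<open>lucas x\<close> and \<open>M = m(n - 1)\<close>, \<open>K = kn - 1\<close>. The numerator index splits as
  \<open>(dm - l)n - (m - 1)d = (M - K)d + (kd - l)n\<close>, so the addition formula
  \<open>{x + y} = {x}{y + 1} + t{x - 1}{y}\<close> with \<open>x = (M - K)d\<close> and \<open>y = (kd - l)n\<close> turns
  \<open>{x + y}\<close> times the Lucasnomial of \<open>M\<close> over \<open>K\<close> into a sum of two terms.
  In the second one, \<open>{(kd - l)n}\<close> is divisible by \<open>{gn}\<close> because \<open>g\<close> divides \<open>kd - l\<close>.
  In the first one, the absorption identity
  moves \<open>{(M - K)d}\<close> times the Lucasnomial over \<open>K\<close> into \<open>{(K + 1)d}\<close> times the Lucasnomial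
  over \<open>K + 1\<close>, and \<open>{(K + 1)d} = {knd}\<close> is divisible by \<open>{gn}\<close> because \<open>g\<close> divides \<open>kd\<close>.

  What remains is that the quotients \<open>{y}/{c}\<close> for \<open>c\<close> dividing \<open>y\<close> and the Lucasnomials
  themselves have nonnegative integer coefficients. Both follow by induction, again from the
  addition formula, whose terms all carry a plus sign. Every division is expressed by
  exhibiting a cofactor with nonnegative coefficients, so fractions enter only at the end.
\<close>

definition nonneg_coeffs :: "int poly poly \<Rightarrow> bool" where
  "nonneg_coeffs p \<longleftrightarrow> (\<forall>i j. coeff (coeff p j) i \<ge> 0)"

lemma nonneg_coeffs_add:
  "nonneg_coeffs p \<Longrightarrow> nonneg_coeffs q \<Longrightarrow> nonneg_coeffs (p + q)"
  by (simp add: nonneg_coeffs_def)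

lemma nonneg_coeffs_mult:
  "nonneg_coeffs p \<Longrightarrow> nonneg_coeffs q \<Longrightarrow> nonneg_coeffs (p * q)"
  by (simp add: nonneg_coeffs_def coeff_mult coeff_sum sum_nonneg)

lemma nonneg_coeffs_0: "nonneg_coeffs 0"
  by (simp add: nonneg_coeffs_def)

lemma nonneg_coeffs_1: "nonneg_coeffs 1"
  by (auto simp: nonneg_coeffs_def coeff_1)

lemma nonneg_coeffs_var_s: "nonneg_coeffs var_s"
  by (auto simp: nonneg_coeffs_def var_s_def coeff_pCons split: nat.split)

lemma nonneg_coeffs_var_t: "nonneg_coeffs var_t"
  by (auto simp: nonneg_coeffs_def var_t_def coeff_pCons coeff_1 split: nat.split)

lemma nonneg_coeffs_lucas: "nonneg_coeffs (lucas n)"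
  by (induction n rule: lucas.induct)
    (simp_all add: nonneg_coeffs_0 nonneg_coeffs_1 nonneg_coeffs_add nonneg_coeffs_mult
      nonneg_coeffs_var_s nonneg_coeffs_var_t)

lemmas nonneg_coeffs_intros =
  nonneg_coeffs_add nonneg_coeffs_mult nonneg_coeffs_0 nonneg_coeffs_1
  nonneg_coeffs_var_t nonneg_coeffs_lucas

text \<open>
  In \<open>y\<close> both sides satisfy the Lucas recurrence, so they agree once they agree at \<open>y = 0\<close>
  and \<open>y = 1\<close>.
\<close>
lemma lucas_add:
  "lucas (Suc x + y) = lucas (Suc x) * lucas (Suc y) + var_t * lucas x * lucas y"
proof (induction y rule: lucas.induct)
  case 2
  show ?case by (simp add: algebra_simps)
next
  case (3 y)
  have "lucas (Suc x + Suc (Suc y)) = var_s * lucas (Suc x + Suc y) + var_t * lucas (Suc x + y)"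
    by simp
  also have "\<dots> = lucas (Suc x) * lucas (Suc (Suc (Suc y)))
      + var_t * lucas x * lucas (Suc (Suc y))"
    unfolding 3 by (simp only: lucas.simps algebra_simps)
  finally show ?case .
qed simp

text \<open>
  Adding \<open>a\<close> to a multiple of \<open>a\<close> leaves two terms, one with the factor \<open>{a}\<close> and one with the
  factor \<open>{ab}\<close>, so divisibility by \<open>{a}\<close> passes from \<open>ab\<close> to \<open>ab + a\<close>.
\<close>
lemma lucas_dvd_nonneg:
  assumes "a dvd y"
  shows "\<exists>q. nonneg_coeffs q \<and> lucas y = lucas a * q"
proof (cases "a = 0")
  case True
  with assms show ?thesis by (auto intro: nonneg_coeffs_0)
next
  case False
  then obtain a' where a: "a = Suc a'" by (metis not0_implies_Suc)
  have "\<exists>q. nonneg_coeffs q \<and> lucas (a * b) = lucas a * q" for b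
  proof (induction b)
    case 0
    show ?case by (auto intro: nonneg_coeffs_0)
  next
    case (Suc b)
    then obtain q where q: "nonneg_coeffs q" "lucas (a * b) = lucas a * q" by blast
    have "lucas (a * Suc b) = lucas (Suc a' + a * b)"
      by (simp add: a)
    also have "\<dots> = lucas a * lucas (Suc (a * b)) + var_t * lucas a' * lucas (a * b)"
      by (simp only: lucas_add a)
    also have "\<dots> = lucas a * (lucas (Suc (a * b)) + var_t * lucas a' * q)"
      by (simp only: q(2) algebra_simps)
    finally have eq: "lucas (a * Suc b) = \<dots>" .
    show ?case
      by (rule exI, rule conjI[OF _ eq]) (intro nonneg_coeffs_intros q(1))
  qed
  with assms show ?thesis by (auto simp: dvd_def)
qed

lemma lucastorial_0 [simp]: "lucastorial 0 d = 1"
  by (simp add: lucastorial_def)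

lemma lucastorial_Suc: "lucastorial (Suc n) d = lucastorial n d * lucas (Suc n * d)"
  by (simp add: lucastorial_def)

text \<open>
  The cofactor is the Lucasnomial. Splitting \<open>{(a + b)d}\<close> by the addition formula gives the
  Pascal-type recurrence: one term supplies the missing factor \<open>{ad}\<close> to the decomposition for
  \<open>(a - 1, b)\<close>, the other supplies \<open>{bd}\<close> to the one for \<open>(a, b - 1)\<close>.
\<close>
lemma lucastorial_add_nonneg:
  assumes "d > 0"
  shows "\<exists>p. nonneg_coeffs p \<and> lucastorial (a + b) d = p * lucastorial a d * lucastorial b d"
proof (induction "a + b" arbitrary: a b)
  case 0
  then show ?case by (auto intro: nonneg_coeffs_1)
next
  case (Suc N)
  show ?case
  proof (cases "a = 0 \<or> b = 0")
    case True
    then show ?thesis by (auto intro!: exI[of _ 1] nonneg_coeffs_1)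
  next
    case False
    then obtain a' b' where ab: "a = Suc a'" "b = Suc b'"
      by (metis not0_implies_Suc)
    have "N = a' + b" "N = a + b'"
      using Suc.hyps(2) ab by simp_all
    with Suc.hyps(1) obtain p q where
      p: "nonneg_coeffs p" "lucastorial N d = p * lucastorial a' d * lucastorial b d" and
      q: "nonneg_coeffs q" "lucastorial N d = q * lucastorial a d * lucastorial b' d"
      by metis
    define x where "x = a * d - 1"
    have x: "a * d = Suc x"
      using assms ab by (simp add: x_def)
    have "Suc N * d = Suc x + b * d"
      unfolding Suc.hyps(2) x[symmetric] by (rule add_mult_distrib)
    then have split: "lucas (Suc N * d) =
        lucas (a * d) * lucas (Suc (b * d)) + var_t * lucas x * lucas (b * d)"
      by (simp only: lucas_add x)
    have "lucastorial (a + b) d = lucastorial N d * lucas (Suc N * d)"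
      by (simp only: Suc.hyps(2)[symmetric] lucastorial_Suc)
    also have "\<dots> = lucastorial N d * lucas (a * d) * lucas (Suc (b * d))
                   + lucastorial N d * lucas (b * d) * (var_t * lucas x)"
      unfolding split by (simp only: algebra_simps)
    also have "lucastorial N d * lucas (a * d) = p * lucastorial a d * lucastorial b d"
      by (simp only: p(2) ab(1) lucastorial_Suc ac_simps)
    also have "lucastorial N d * lucas (b * d) = q * lucastorial a d * lucastorial b d"
      by (simp only: q(2) ab(2) lucastorial_Suc ac_simps)
    finally have eq: "lucastorial (a + b) d =
        (p * lucas (Suc (b * d)) + q * (var_t * lucas x)) * lucastorial a d * lucastorial b d"
      by (simp only: algebra_simps)
    show ?thesis
      by (rule exI, rule conjI[OF _ eq]) (intro nonneg_coeffs_intros p(1) q(1))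
  qed
qed

text \<open>
  This is the divisibility behind the theorem, with \<open>b = M - K\<close>. The two hypotheses on \<open>c\<close>
  serve the two terms of the addition formula for \<open>{bd + r}\<close>: the first term is divisible
  after absorption, since \<open>{bd}\<close> times the Lucasnomial over \<open>K\<close> equals \<open>{(K + 1)d}\<close> times the
  one over \<open>K + 1\<close>, and the second term contains \<open>{r}\<close>.
\<close>
lemma lucas_mult_lucastorial_nonneg:
  assumes d: "d > 0" and c: "c dvd Suc K * d" "c dvd r"
  shows "\<exists>p. nonneg_coeffs p \<and> lucas (b * d + r) * lucastorial (K + b) d
           = p * (lucas c * (lucastorial K d * lucastorial b d))"
proof -
  obtain u where u: "nonneg_coeffs u" "lucas (Suc K * d) = lucas c * u"
    using lucas_dvd_nonneg[OF c(1)] by blast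
  obtain v where v: "nonneg_coeffs v" "lucas r = lucas c * v"
    using lucas_dvd_nonneg[OF c(2)] by blast
  show ?thesis
  proof (cases b)
    \<comment> \<open>Here \<open>bd = 0\<close> has no predecessor, and \<open>{r}\<close> alone accounts for \<open>{c}\<close>.\<close>
    case 0
    then show ?thesis
      using v by (auto intro!: exI[of _ v])
  next
    case (Suc b')
    obtain p where p: "nonneg_coeffs p"
        "lucastorial (K + b) d = p * lucastorial (Suc K) d * lucastorial b' d"
      using lucastorial_add_nonneg[OF d, of "Suc K" b'] Suc by auto
    obtain q where q: "nonneg_coeffs q"
        "lucastorial (K + b) d = q * lucastorial K d * lucastorial b d"
      using lucastorial_add_nonneg[OF d, of K b] by auto
    have last_factor: "lucastorial b d = lucastorial b' d * lucas (b * d)"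
      by (simp only: Suc lucastorial_Suc)
    define x where "x = b * d - 1"
    have x: "b * d = Suc x"
      using d Suc by (simp add: x_def)
    have "lucas (b * d + r) * lucastorial (K + b) d
        = (lucastorial (K + b) d * lucas (b * d)) * lucas (Suc r)
          + lucastorial (K + b) d * (var_t * lucas x * lucas r)"
      unfolding x lucas_add by (simp only: algebra_simps)
    also have "lucastorial (K + b) d * lucas (b * d)
        = p * u * (lucas c * (lucastorial K d * lucastorial b d))"
      unfolding p(2) lucastorial_Suc u(2) last_factor by (simp only: ac_simps)
    also have "lucastorial (K + b) d * (var_t * lucas x * lucas r)
        = q * (var_t * lucas x * v) * (lucas c * (lucastorial K d * lucastorial b d))"
      by (simp only: q(2) v(2) ac_simps)
    finally have eq: "lucas (b * d + r) * lucastorial (K + b) d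
        = (p * u * lucas (Suc r) + q * (var_t * lucas x * v))
          * (lucas c * (lucastorial K d * lucastorial b d))"
      by (simp only: algebra_simps)
    show ?thesis
      by (rule exI, rule conjI[OF _ eq]) (intro nonneg_coeffs_intros p(1) q(1) u(1) v(1))
  qed
qed

lemma lucas_quotient_mult_lucasnomial_in_nat_polys:
  assumes d: "d > 0" and c: "c dvd Suc K * d" "c dvd r" and KM: "K \<le> M"
  shows "Fract (lucas ((M - K) * d + r)) (lucas c) * lucasnomial M K d \<in> nat_polys"
proof -
  obtain p where p: "nonneg_coeffs p" "lucas ((M - K) * d + r) * lucastorial M d
      = p * (lucas c * (lucastorial K d * lucastorial (M - K) d))"
    using lucas_mult_lucastorial_nonneg[OF d c, of "M - K"] KM by auto
  have "c > 0"
    using c(1) d by (auto intro: Nat.gr0I)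
  then have "lucas c * (lucastorial K d * lucastorial (M - K) d) \<noteq> 0"
    using d by (simp add: lucas_nonzero lucastorial_nonzero)
  then have "Fract (lucas ((M - K) * d + r)) (lucas c) * lucasnomial M K d = Fract p 1"
    by (simp add: lucasnomial_def eq_fract p(2))
  with p(1) show ?thesis
    unfolding nat_polys_def nonneg_coeffs_def by blast
qed

theorem theorem5p5:
  fixes d k l m n g :: nat
  assumes "d > 0" and "k > 0" and "l > 0" and "m > 0" and "n > 0"
    and "l < k * d" and "k * d < m * d"
    and "k * n - 1 \<le> m * (n - 1)"
    and "g = gcd (k * d) (k * d - l)"
  shows "Fract (lucas ((d * m - l) * n - (m - 1) * d)) (lucas (g * n))
           * lucasnomial (m * (n - 1)) (k * n - 1) d \<in> nat_polys"
proof -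
  define M K r where "M = m * (n - 1)" and "K = k * n - 1" and "r = (k * d - l) * n"
  have K: "Suc K = k * n"
    using assms(2,5) by (simp add: K_def)
  have "g * n dvd (k * d) * n" "g * n dvd r"
    unfolding r_def assms(9) by (intro mult_dvd_mono gcd_dvd1 gcd_dvd2 dvd_refl)+
  then have c: "g * n dvd Suc K * d" "g * n dvd r"
    by (simp_all only: K ac_simps)
  have KM: "K \<le> M"
    using assms(8) by (simp add: K_def M_def)
  have index: "(d * m - l) * n - (m - 1) * d = (M - K) * d + r"
  proof -
    have M: "int M = int m * int n - int m"
      using assms(5) by (simp add: M_def right_diff_distrib')
    have K': "int K = int k * int n - 1"
      using K by (metis add_diff_cancel_right' of_nat_Suc of_nat_mult add.commute)
    have r: "int r = (int k * int d - int l) * int n"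
      using assms(6) by (simp add: r_def of_nat_diff)
    have "int ((M - K) * d + r) = (int M - int K) * int d + int r"
      using KM by simp
    also have "\<dots> = (int d * int m - int l) * int n - (int m - 1) * int d"
      unfolding M K' r by (simp add: algebra_simps)
    finally have "int ((M - K) * d + r)
        = (int d * int m - int l) * int n - (int m - 1) * int d" .
    with index_no_truncation(1)[OF assms(1-8)] show ?thesis
      by (simp only: flip: of_nat_eq_iff[where 'a = int])
  qed
  show ?thesis
    using lucas_quotient_mult_lucasnomial_in_nat_polys[OF assms(1) c KM]
    unfolding index M_def K_def .
qed

end
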